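(* Let $X$ be a non-degenerate real-valued random variable (i.e., $X$ is not almost surely constant), and let $n$ be a positive integer with $\mathsf{E}[|X|^n]<\infty$. (i) If $n\ge2$, then $|\kappa_n(X)|<C^{\mathrm{raw}}_n\,\mathsf{E}[|X|^n]$. (ii) If $n\ge3$, then $|\kappa_n(X)|<C^{\mathrm{cen}}_n\,\mathsf{E}\big[|X-\mathsf{E}[X]|^n\big]$. (iii) If $X$ is symmetric (i.e. $X$ and $-X$ have the same distribution) and $n\ge4$ is even, then $|\kappa_n(X)|<C^{\mathrm{sym}}_n\,\mathsf{E}[|X|^n]$.
   Context: $\mathcal{P}(n)$ is the set of all set partitions of $\{1,\dots,n\}$ into nonempty blocks, and $|\pi|$ is the number of blocks of $\pi$. For a random variable $X$ with $\mathsf{E}[|X|^n]<\infty$, write $m_k=\mathsf{E}[X^k]$ for $1\le k\le n$; the $n$-th cumulant is $$\kappa_n(X)=\sum_{\pi\in\mathcal{P}(n)}(-1)^{|\pi|-1}(|\pi|-1)!\prod_{B\in\pi}m_{|B|}.$$ The coefficients are $$C^{\mathrm{raw}}_n=\sum_{\pi\in\mathcal{P}(n)}(|\pi|-1)!,\qquad C^{\mathrm{cen}}_n=\sum_{\substack{\pi\in\mathcal{P}(n)\\ |B|\ge2\ \forall B\in\pi}}(|\pi|-1)!,\qquad C^{\mathrm{sym}}_n=\sum_{\substack{\pi\in\mathcal{P}(n)\\ |B|\text{ even }\forall B\in\pi}}(|\pi|-1)!.$$ *)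

theory Defs
  imports "HOL-Probability.Probability"
begin

definition set_partitions :: "nat \<Rightarrow> nat set set set" where
  "set_partitions n = {P. partition_on {1..n} P}"

lemma finite_set_partitions: "finite (set_partitions n)"
  unfolding set_partitions_def by (rule finitely_many_partition_on) simp

definition moment :: "'a measure \<Rightarrow> ('a \<Rightarrow> real) \<Rightarrow> nat \<Rightarrow> real" where
  "moment M X k = (\<integral>x. X x ^ k \<partial>M)"

(* Meaningful when M is a probability space, n > 0 and |X|^n is integrable:
   the integrals occurring here would otherwise be 0 by convention. *)
definition cumulant :: "'a measure \<Rightarrow> ('a \<Rightarrow> real) \<Rightarrow> nat \<Rightarrow> real" where
  "cumulant M X n =
     (\<Sum>P\<in>set_partitions n.
        (-1) ^ (card P - 1) * fact (card P - 1) * (\<Prod>B\<in>P. moment M X (card B)))"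

definition C_raw :: "nat \<Rightarrow> nat" where
  "C_raw n = (\<Sum>P\<in>set_partitions n. fact (card P - 1))"

definition C_cen :: "nat \<Rightarrow> nat" where
  "C_cen n = (\<Sum>P\<in>{P \<in> set_partitions n. \<forall>B\<in>P. card B \<ge> 2}. fact (card P - 1))"

definition C_sym :: "nat \<Rightarrow> nat" where
  "C_sym n = (\<Sum>P\<in>{P \<in> set_partitions n. \<forall>B\<in>P. even (card B)}. fact (card P - 1))"

definition symmetric_rv :: "'a measure \<Rightarrow> ('a \<Rightarrow> real) \<Rightarrow> bool" where
  "symmetric_rv M X \<longleftrightarrow> distr M borel X = distr M borel (\<lambda>x. - X x)"

end

theory Submission
  imports Defs
begin

text \<open>
  Put \<open>L = E |X|^n\<close>. By Lyapunov's inequality \<open>E |X|^k \<le> L^(k/n)\<close> for \<open>k \<le> n\<close>. The block sizes of a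
  partition of \<open>{1..n}\<close> add up to \<open>n\<close>, so every product of moments in the cumulant formula is at most
  \<open>L\<close> in absolute value (\<open>abs_prod_moment_le\<close>), and summing the weights \<open>(|\<pi>| - 1)!\<close> gives the
  bounds with \<open>\<le>\<close>. In the centred and the symmetric case the partitions with a singleton block,
  respectively with a block of odd size, contribute zero and drop out of the constant.

  Strictness only needs a signed term above \<open>-L\<close> and a signed term below \<open>L\<close>, possibly the same one
  (\<open>abs_cumulant_less\<close>). For the raw bound the partition into singletons serves as both: its product
  is \<open>(E X)^n\<close>, and \<open>\<bar>E X\<bar>^n < L\<close> because the variance is positive. For even \<open>n \<ge> 4\<close> two partitions
  have terms of opposite sign: the one-block partition gives \<open>m\<^sub>n \<ge> 0\<close>, and \<open>{{1,2},{3..n}}\<close> gives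
  \<open>- m\<^sub>2 m\<^bsub>n-2\<^esub> \<le> 0\<close>. For odd \<open>n\<close> and centred \<open>X\<close> the one-block partition suffices, since
  \<open>\<bar>m\<^sub>n\<bar> = L\<close> would force \<open>X\<close> to have constant sign, hence to vanish.

  The centred bound also uses \<open>\<kappa>\<^sub>n(X + a) = \<kappa>\<^sub>n(X)\<close> for \<open>n \<ge> 2\<close> (\<open>cumulant_shift\<close>). This is proved on
  partitions alone: \<open>X\<close> is replaced by \<open>X + a\<close> at one of the \<open>n\<close> positions at a time, and each
  replacement changes the joint cumulant by \<open>a\<close> times a joint cumulant with one constant argument,
  which is zero (\<open>partition_cumulant_delete_point\<close>).
\<close>

section \<open>Alternating sums over set partitions\<close>

text \<open>
  The joint cumulant of random variables \<open>Y\<^sub>i\<close>, for \<open>i\<close> in \<open>A\<close>, as a function of their mixed moments: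
  \<open>f B\<close> stands for the expectation of the product of the \<open>Y\<^sub>i\<close> with \<open>i\<close> in \<open>B\<close>. Indexing by sets
  rather than block sizes lets the variables differ from one position to the next.
\<close>

definition partition_cumulant :: "'b set \<Rightarrow> ('b set \<Rightarrow> real) \<Rightarrow> real" where
  "partition_cumulant A f =
     (\<Sum>P | partition_on A P. (-1) ^ (card P - 1) * fact (card P - 1) * (\<Prod>B\<in>P. f B))"

lemma partition_cumulant_cong:
  assumes "\<And>B. B \<subseteq> A \<Longrightarrow> f B = g B"
  shows "partition_cumulant A f = partition_cumulant A g"
  unfolding partition_cumulant_def
proof (intro sum.cong refl arg_cong2[where f = "(*)"] prod.cong)
  fix P B assume "P \<in> {P. partition_on A P}" "B \<in> P"
  then have "B \<subseteq> A" by (auto simp: partition_on_def)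
  then show "f B = g B" by (rule assms)
qed

lemma partition_on_add_point:
  assumes \<sigma>: "partition_on I \<sigma>" and C: "C \<in> insert {} \<sigma>" and j: "j \<notin> I"
  shows "partition_on (insert j I) (insert (insert j C) (\<sigma> - {C}))"
proof (subst partition_on_insert)
  have disj: "C \<inter> \<Union>(\<sigma> - {C}) = {}"
    using \<sigma> C by (auto simp: partition_on_def disjoint_def)
  have jn: "j \<notin> \<Union>\<sigma>" using \<sigma> j by (simp add: partition_on_def)
  show "disjnt (insert j C) (\<Union> (\<sigma> - {C}))"
    using disj jn by (auto simp: disjnt_iff)
  have U: "\<Union>(\<sigma> - {C}) = I - C"
    using disj C \<sigma> by (auto simp: partition_on_def)
  have "partition_on (I - C) (\<sigma> - {C})"
    unfolding partition_on_def
  proof (intro conjI)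
    show "disjoint (\<sigma> - {C})" 
      using partition_onD2[OF \<sigma>] by (rule pairwise_subset) auto
  qed (use U \<sigma> in \<open>auto simp: partition_on_def\<close>)
  moreover have "insert j I - insert j C = I - C" using j by auto
  moreover have "C \<subseteq> I" using C \<sigma> by (auto simp: partition_on_def)
  ultimately show "partition_on (insert j I - insert j C) (\<sigma> - {C}) \<and>
      insert j C \<subseteq> insert j I \<and> insert j C \<noteq> {}" by auto
qed

lemma partition_on_unique_block:
  assumes "partition_on A P" "j \<in> A"
  obtains D where "D \<in> P" "j \<in> D" "\<And>B. B \<in> P \<Longrightarrow> j \<in> B \<Longrightarrow> B = D"
proof -
  from assms obtain D where D: "D \<in> P" "j \<in> D" by (auto simp: partition_on_def)
  have "B = D" if "B \<in> P" "j \<in> B" for B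
    using disjointD[OF partition_onD2[OF assms(1)] that(1) D(1)] that D by blast
  with D show thesis by (rule that)
qed

text \<open>
  A partition of \<open>insert j I\<close> is a partition of \<open>I\<close> together with a place for \<open>j\<close>: one of its blocks
  \<open>C\<close>, or a new block, encoded as \<open>C = {}\<close>. The inverse map deletes \<open>j\<close> from every block and discards
  the empty set that remains if \<open>j\<close> was alone.
\<close>
lemma sum_partition_on_insert:
  fixes h :: "'b set set \<Rightarrow> real"
  assumes fin: "finite I" and j: "j \<notin> I"
  shows "(\<Sum>P | partition_on (insert j I) P. h P) =
         (\<Sum>\<sigma> | partition_on I \<sigma>. \<Sum>C\<in>insert {} \<sigma>. h (insert (insert j C) (\<sigma> - {C})))"
proof -
  have fin\<sigma>: "finite \<sigma>" if "partition_on I \<sigma>" for \<sigma>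
    using finite_elements[OF fin that] .
  have "(\<Sum>\<sigma> | partition_on I \<sigma>. \<Sum>C\<in>insert {} \<sigma>. h (insert (insert j C) (\<sigma> - {C}))) =
        (\<Sum>(\<sigma>, C) \<in> (SIGMA \<sigma>:{\<sigma>. partition_on I \<sigma>}. insert {} \<sigma>). h (insert (insert j C) (\<sigma> - {C})))"
    by (rule sum.Sigma) (use fin\<sigma> finitely_many_partition_on[OF fin] in auto)
  also have "\<dots> = (\<Sum>P | partition_on (insert j I) P. h P)"
  proof (rule sum.reindex_bij_witness[where
      j = "\<lambda>(\<sigma>, C). insert (insert j C) (\<sigma> - {C})" and
      i = "\<lambda>P. ((\<lambda>B. B - {j}) ` P - {{}}, \<Union>{B\<in>P. j \<in> B} - {j})"])
    fix a assume "a \<in> (SIGMA \<sigma>:{\<sigma>. partition_on I \<sigma>}. insert {} \<sigma>)"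
    then obtain \<sigma> C where a: "a = (\<sigma>, C)" and \<sigma>: "partition_on I \<sigma>" and C: "C \<in> insert {} \<sigma>"
      by auto
    have jB: "j \<notin> B" if "B \<in> insert {} \<sigma>" for B
      using that \<sigma> j by (auto simp: partition_on_def)
    have ne: "{} \<notin> \<sigma>" using \<sigma> by (simp add: partition_on_def)
    have "(\<lambda>B. B - {j}) ` (\<sigma> - {C}) = (\<lambda>B. B) ` (\<sigma> - {C})"
      by (rule image_cong) (use jB in auto)
    then have 1: "(\<lambda>B. B - {j}) ` insert (insert j C) (\<sigma> - {C}) - {{}} = \<sigma>"
      using jB[OF C] C ne by auto
    have "{B \<in> insert (insert j C) (\<sigma> - {C}). j \<in> B} = {insert j C}"
      using jB by auto
    then have 2: "\<Union>{B \<in> insert (insert j C) (\<sigma> - {C}). j \<in> B} - {j} = C"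
      using jB[OF C] by simp
    show "(case case a of (\<sigma>, C) \<Rightarrow> insert (insert j C) (\<sigma> - {C}) of
            P \<Rightarrow> ((\<lambda>B. B - {j}) ` P - {{}}, \<Union>{B\<in>P. j \<in> B} - {j})) = a"
      unfolding a prod.case by (simp only: 1 2)
    show "(case a of (\<sigma>, C) \<Rightarrow> insert (insert j C) (\<sigma> - {C})) \<in> {P. partition_on (insert j I) P}"
      unfolding a using partition_on_add_point[OF \<sigma> C j] by simp
    show "h (case a of (\<sigma>, C) \<Rightarrow> insert (insert j C) (\<sigma> - {C})) =
       (case a of (\<sigma>, C) \<Rightarrow> h (insert (insert j C) (\<sigma> - {C})))"
      by (simp add: a)
  next
    fix P assume "P \<in> {P. partition_on (insert j I) P}"
    then have P: "partition_on (insert j I) P" by simp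
    from P obtain D where D: "D \<in> P" "j \<in> D" and uniq: "\<And>B. B \<in> P \<Longrightarrow> j \<in> B \<Longrightarrow> B = D"
      using partition_on_unique_block[of "insert j I" P j] by blast
    have blk: "{B\<in>P. j \<in> B} = {D}" using D uniq by blast
    have ne: "{} \<notin> P" using P by (simp add: partition_on_def)
    have "(\<lambda>B. B - {j}) ` (P - {D}) = (\<lambda>B. B) ` (P - {D})"
      by (rule image_cong) (use uniq in blast)+
    moreover have "P = insert D (P - {D})" using D by auto
    ultimately have "(\<lambda>B. B - {j}) ` P = insert (D - {j}) (P - {D})"
      by (metis image_ident image_insert)
    then have restr: "(\<lambda>B. B - {j}) ` P - {{}} = insert (D - {j}) (P - {D}) - {{}}" by simp
    have notin: "D - {j} \<notin> P - {D}"
    proof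
      assume "D - {j} \<in> P - {D}"
      then have "D - {j} \<in> P" "D - {j} \<noteq> D" by blast+
      then have "(D - {j}) \<inter> D = {}" and "D - {j} \<noteq> {}"
        using disjointD[OF partition_onD2[OF P] _ D(1)] ne by metis+
      then show False by blast
    qed
    have "(insert (D - {j}) (P - {D}) - {{}}) - {D - {j}} = P - {D}"
      using notin ne by blast
    moreover have "insert j (D - {j}) = D" using D by blast
    ultimately have "insert (insert j (D - {j})) ((insert (D - {j}) (P - {D}) - {{}}) - {D - {j}}) = P"
      using D by (simp only: insert_Diff)
    then show "(case ((\<lambda>B. B - {j}) ` P - {{}}, \<Union>{B\<in>P. j \<in> B} - {j}) of
             (\<sigma>, C) \<Rightarrow> insert (insert j C) (\<sigma> - {C})) = P"
      by (simp add: restr blk)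
    have "partition_on (I \<inter> insert j I) ((\<inter>) I ` P - {{}})"
      using P by (rule partition_on_restrict)
    moreover have "(\<inter>) I ` P = (\<lambda>B. B - {j}) ` P"
      by (rule image_cong) (use P j in \<open>auto simp: partition_on_def\<close>)
    moreover have "I \<inter> insert j I = I" by auto
    ultimately have "partition_on I ((\<lambda>B. B - {j}) ` P - {{}})" by simp
    then show "((\<lambda>B. B - {j}) ` P - {{}}, \<Union>{B\<in>P. j \<in> B} - {j})
        \<in> (SIGMA \<sigma>:{\<sigma>. partition_on I \<sigma>}. insert {} \<sigma>)"
      by (auto simp: restr blk)
  qed
  finally show ?thesis by (rule sym)
qed

text \<open>
  A joint cumulant with a constant argument \<open>1\<close> at position \<open>j\<close> is zero. Deleting \<open>j\<close> makes the product
  depend only on the induced partition \<open>\<sigma>\<close> of \<open>I\<close>. If \<open>\<sigma>\<close> has \<open>k\<close> blocks, then \<open>j\<close> can join any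
  of them, with total weight \<open>k (-1)^(k-1) (k-1)!\<close>, or form its own block, with weight \<open>(-1)^k k!\<close>,
  and these cancel. Since \<open>I\<close> is nonempty, \<open>k \<ge> 1\<close>; a cumulant of the single argument \<open>1\<close> would be \<open>1\<close>.
\<close>
lemma partition_cumulant_delete_point:
  assumes fin: "finite I" and j: "j \<notin> I" and "I \<noteq> {}" and f: "f {} = 1"
  shows "partition_cumulant (insert j I) (\<lambda>B. f (B - {j})) = 0"
proof -
  let ?c = "\<lambda>k. (-1) ^ (k - 1) * fact (k - 1) :: real"
  have "partition_cumulant (insert j I) (\<lambda>B. f (B - {j})) =
     (\<Sum>\<sigma> | partition_on I \<sigma>. \<Sum>C\<in>insert {} \<sigma>.
        ?c (card (insert (insert j C) (\<sigma> - {C}))) * (\<Prod>B\<in>insert (insert j C) (\<sigma> - {C}). f (B - {j})))"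
    unfolding partition_cumulant_def by (rule sum_partition_on_insert[OF fin j])
  also have "\<dots> = (\<Sum>\<sigma> | partition_on I \<sigma>. 0)"
  proof (intro sum.cong refl)
    fix \<sigma> assume "\<sigma> \<in> {\<sigma>. partition_on I \<sigma>}"
    then have \<sigma>: "partition_on I \<sigma>" by simp
    have fin\<sigma>: "finite \<sigma>" using finite_elements[OF fin \<sigma>] .
    have ne: "{} \<notin> \<sigma>" using \<sigma> by (simp add: partition_on_def)
    have jB: "B - {j} = B" "j \<notin> B" if "B \<in> insert {} \<sigma>" for B
      using that \<sigma> j by (auto simp: partition_on_def)
    have new: "insert j C \<notin> \<sigma> - {C}" for C using jB(2) by auto
    have "\<sigma> \<noteq> {}" using \<sigma> \<open>I \<noteq> {}\<close> by (auto simp: partition_on_def)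
    then obtain k where k: "card \<sigma> = Suc k" using fin\<sigma> by (cases "card \<sigma>") auto
    have prod: "(\<Prod>B\<in>insert (insert j C) (\<sigma> - {C}). f (B - {j})) = prod f \<sigma>"
      if C: "C \<in> insert {} \<sigma>" for C
    proof -
      have "(\<Prod>B\<in>insert (insert j C) (\<sigma> - {C}). f (B - {j})) = f C * (\<Prod>B\<in>\<sigma> - {C}. f (B - {j}))"
        using fin\<sigma> new jB[OF C] by simp
      also have "(\<Prod>B\<in>\<sigma> - {C}. f (B - {j})) = prod f (\<sigma> - {C})"
        by (rule prod.cong) (use jB in auto)
      also have "f C * prod f (\<sigma> - {C}) = prod f \<sigma>"
        using C ne f prod.remove[OF fin\<sigma>, of C f] by (cases "C = {}") auto
      finally show ?thesis .
    qed
    have card: "card (insert (insert j C) (\<sigma> - {C})) = (if C = {} then Suc (Suc k) else Suc k)"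
      if "C \<in> insert {} \<sigma>" for C
      using that ne fin\<sigma> new[of C] k by (auto simp: card_Suc_Diff1)
    have "(\<Sum>C\<in>insert {} \<sigma>. ?c (card (insert (insert j C) (\<sigma> - {C}))) *
             (\<Prod>B\<in>insert (insert j C) (\<sigma> - {C}). f (B - {j})))
        = (\<Sum>C\<in>insert {} \<sigma>. ?c (if C = {} then Suc (Suc k) else Suc k) * prod f \<sigma>)"
      by (intro sum.cong refl) (simp only: prod card)
    also have "\<dots> = ?c (Suc (Suc k)) * prod f \<sigma> + (\<Sum>C\<in>\<sigma>. ?c (Suc k) * prod f \<sigma>)"
      by (subst sum.insert[OF fin\<sigma> ne]) (intro arg_cong2[where f = "(+)"] sum.cong refl; use ne in auto)
    also have "\<dots> = 0" by (simp add: k algebra_simps)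
    finally show "(\<Sum>C\<in>insert {} \<sigma>. ?c (card (insert (insert j C) (\<sigma> - {C}))) *
             (\<Prod>B\<in>insert (insert j C) (\<sigma> - {C}). f (B - {j}))) = 0" .
  qed
  finally show ?thesis by simp
qed

text \<open>
  Adding the constant \<open>a\<close> to the variable at position \<open>j\<close> changes the mixed moments in this way. Exactly
  one block contains \<open>j\<close>, so the product over the blocks is affine in \<open>a\<close>, and its slope is a
  product in which \<open>j\<close> has been deleted.
\<close>
lemma partition_cumulant_shift_point:
  assumes fin: "finite A" and j: "j \<in> A" and "A \<noteq> {j}" and f: "f {} = 1"
  shows "partition_cumulant A (\<lambda>B. f B + (if j \<in> B then a * f (B - {j}) else 0)) =
         partition_cumulant A f"
proof -
  let ?g = "\<lambda>B. f B + (if j \<in> B then a * f (B - {j}) else 0)"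
  let ?d = "\<lambda>B. f (B - {j})"
  have prod: "prod ?g P = prod f P + a * prod ?d P" if P: "partition_on A P" for P
  proof -
    have finP: "finite P" using finite_elements[OF fin P] .
    obtain D where D: "D \<in> P" "j \<in> D" and uniq: "\<And>B. B \<in> P \<Longrightarrow> j \<in> B \<Longrightarrow> B = D"
      using partition_on_unique_block[OF P j] by blast
    have "j \<notin> B" if "B \<in> P - {D}" for B using uniq that by blast
    then have "prod ?g (P - {D}) = prod f (P - {D})" "prod ?d (P - {D}) = prod f (P - {D})"
      by (auto intro!: prod.cong)
    then show ?thesis
      using prod.remove[OF finP D(1), of ?g] prod.remove[OF finP D(1), of ?d]
        prod.remove[OF finP D(1), of f] D by (simp add: algebra_simps)
  qed
  have "partition_cumulant A ?g = partition_cumulant A f + a * partition_cumulant A ?d"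
    unfolding partition_cumulant_def sum_distrib_left sum.distrib[symmetric]
    by (intro sum.cong refl) (simp add: prod algebra_simps)
  also have "partition_cumulant A ?d = 0"
    using partition_cumulant_delete_point[of "A - {j}" j f] assms insert_Diff[OF j] by auto
  finally show ?thesis by simp
qed

section \<open>Shift invariance of cumulants\<close>

lemma cumulant_eq_partition_cumulant:
  "cumulant M X n = partition_cumulant {1..n} (\<lambda>B. moment M X (card B))"
  by (simp add: cumulant_def partition_cumulant_def set_partitions_def)

context prob_space
begin

lemma integrable_power_le:
  fixes X :: "'a \<Rightarrow> real"
  assumes [measurable]: "X \<in> borel_measurable M"
    and int: "integrable M (\<lambda>x. \<bar>X x\<bar> ^ n)" and "k \<le> n"
  shows "integrable M (\<lambda>x. X x ^ k)"
proof (rule Bochner_Integration.integrable_bound)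
  show "integrable M (\<lambda>x. 1 + \<bar>X x\<bar> ^ n)" using int by simp
  show "AE x in M. norm (X x ^ k) \<le> norm (1 + \<bar>X x\<bar> ^ n)"
  proof (rule AE_I2)
    fix x
    have "\<bar>X x\<bar> ^ k \<le> 1 + \<bar>X x\<bar> ^ n"
    proof (cases "\<bar>X x\<bar> \<le> 1")
      case True
      then have "\<bar>X x\<bar> ^ k \<le> 1" by (simp add: power_le_one)
      moreover have "0 \<le> \<bar>X x\<bar> ^ n" by simp
      ultimately show ?thesis by linarith
    next
      case False
      then have "\<bar>X x\<bar> ^ k \<le> \<bar>X x\<bar> ^ n" using \<open>k \<le> n\<close> by (intro power_increasing) auto
      then show ?thesis by simp
    qed
    then show "norm (X x ^ k) \<le> norm (1 + \<bar>X x\<bar> ^ n)" by (simp add: power_abs)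
  qed
qed measurable

lemma integrable_power_mult_shift_power:
  fixes X :: "'a \<Rightarrow> real"
  assumes [measurable]: "X \<in> borel_measurable M"
    and int: "integrable M (\<lambda>x. \<bar>X x\<bar> ^ n)" and "p + q \<le> n"
  shows "integrable M (\<lambda>x. X x ^ p * (X x + a) ^ q)"
  using \<open>p + q \<le> n\<close>
proof (induction q arbitrary: p)
  case 0
  then show ?case using integrable_power_le[OF assms(1) int] by simp
next
  case (Suc q)
  have "integrable M (\<lambda>x. X x ^ Suc p * (X x + a) ^ q + a * (X x ^ p * (X x + a) ^ q))"
    using Suc.IH[of "Suc p"] Suc.IH[of p] Suc.prems by simp
  then show ?case by (simp add: algebra_simps)
qed

text \<open>
  \<open>?m T B\<close> below is the mixed moment over \<open>B\<close> when the variable at position \<open>i\<close> is \<open>X + a\<close> for \<open>i\<close> in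
  \<open>T\<close> and \<open>X\<close> otherwise. The set \<open>T\<close> grows from \<open>{}\<close> to \<open>{1..n}\<close> one position at a time.
\<close>
lemma cumulant_shift:
  fixes X :: "'a \<Rightarrow> real"
  assumes X: "X \<in> borel_measurable M"
    and int: "integrable M (\<lambda>x. \<bar>X x\<bar> ^ n)" and "n \<ge> 2"
  shows "cumulant M (\<lambda>x. X x + a) n = cumulant M X n"
proof -
  let ?m = "\<lambda>T B. \<integral>x. X x ^ card (B - T) * (X x + a) ^ card (B \<inter> T) \<partial>M"
  have inv: "partition_cumulant {1..n} (?m T) = partition_cumulant {1..n} (?m {})"
    if "finite T" "T \<subseteq> {1..n}" for T
    using that
  proof (induction T)
    case (insert j T)
    have "partition_cumulant {1..n} (?m (insert j T)) =
        partition_cumulant {1..n} (\<lambda>B. ?m T B + (if j \<in> B then a * ?m T (B - {j}) else 0))"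
    proof (rule partition_cumulant_cong)
      fix B :: "nat set" assume B: "B \<subseteq> {1..n}"
      then have finB: "finite B" by (rule finite_subset) simp
      show "?m (insert j T) B = ?m T B + (if j \<in> B then a * ?m T (B - {j}) else 0)"
      proof (cases "j \<in> B")
        case False
        then have "B - insert j T = B - T" "B \<inter> insert j T = B \<inter> T" by auto
        then show ?thesis using False by simp
      next
        case True
        define p q where "p = card (B - insert j T)" and "q = card (B \<inter> T)"
        have sets: "B - T = insert j (B - insert j T)" "B \<inter> insert j T = insert j (B \<inter> T)"
          "(B - {j}) - T = B - insert j T" "(B - {j}) \<inter> T = B \<inter> T"
          using True insert.hyps by auto
        have cards: "card (B - T) = Suc p" "card (B \<inter> insert j T) = Suc q"
          "card ((B - {j}) - T) = p" "card ((B - {j}) \<inter> T) = q"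
          unfolding sets p_def q_def
          by (rule refl card_insert_disjoint; use finB insert.hyps in blast)+
        have "card B = card (B - T) + card (B \<inter> T)"
          using card_Int_Diff[OF finB, of T] by simp
        moreover have "card B \<le> n" using card_mono[OF _ B] by simp
        ultimately have "Suc p + q \<le> n" using cards by (simp add: q_def)
        then have "integrable M (\<lambda>x. X x ^ Suc p * (X x + a) ^ q)"
          "integrable M (\<lambda>x. a * (X x ^ p * (X x + a) ^ q))"
          using integrable_power_mult_shift_power[OF X int, of "Suc p" q]
            integrable_power_mult_shift_power[OF X int, of p q] by simp_all
        note Bochner_Integration.integral_add[OF this]
        moreover have "(\<lambda>x. X x ^ p * (X x + a) ^ Suc q) =
            (\<lambda>x. X x ^ Suc p * (X x + a) ^ q + a * (X x ^ p * (X x + a) ^ q))"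
          by (simp add: fun_eq_iff algebra_simps)
        ultimately have "(\<integral>x. X x ^ p * (X x + a) ^ Suc q \<partial>M) =
          (\<integral>x. X x ^ Suc p * (X x + a) ^ q \<partial>M) + a * (\<integral>x. X x ^ p * (X x + a) ^ q \<partial>M)"
          by (simp only: integral_mult_right_zero)
        then show ?thesis using True cards by (simp add: p_def[symmetric] q_def[symmetric])
      qed
    qed
    also have "\<dots> = partition_cumulant {1..n} (?m T)"
    proof (rule partition_cumulant_shift_point)
      show "{1..n} \<noteq> {j}"
      proof
        assume "{1..n} = {j}"
        then have "card {1..n} = 1" by (simp only: card.empty card.insert) simp
        with \<open>n \<ge> 2\<close> show False by simp
      qed
    qed (use insert.prems prob_space in auto)
    finally show ?case using insert by simp
  qed simp
  have "cumulant M (\<lambda>x. X x + a) n = partition_cumulant {1..n} (?m {1..n})"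
    unfolding cumulant_eq_partition_cumulant
  proof (rule partition_cumulant_cong)
    fix B :: "nat set" assume "B \<subseteq> {1..n}"
    then have "B - {1..n} = {}" "B \<inter> {1..n} = B" by auto
    then show "moment M (\<lambda>x. X x + a) (card B) = ?m {1..n} B"
      by (simp only: moment_def card.empty power_0 mult_1)
  qed
  also have "\<dots> = partition_cumulant {1..n} (?m {})" by (rule inv) auto
  also have "\<dots> = cumulant M X n"
    unfolding cumulant_eq_partition_cumulant by (simp add: moment_def)
  finally show ?thesis .
qed


end

section \<open>Bounding a product of moments\<close>

text \<open>
  Weighted AM-GM for \<open>y^n\<close> and \<open>1\<close> with weights \<open>k/n\<close> and \<open>1 - k/n\<close>.
\<close>
lemma power_le_weighted_mean:
  fixes y :: real
  assumes "y \<ge> 0" "k \<le> n" "n > 0"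
  shows "y ^ k \<le> real k / real n * y ^ n + (1 - real k / real n)"
proof (cases "y = 0")
  case True
  then show ?thesis using assms by (cases "k = 0") (auto simp: power_0_left divide_le_eq)
next
  case False
  then have "y > 0" using assms by simp
  have "(y ^ n) powr (real k / real n) = (y powr real n) powr (real k / real n)"
    using powr_realpow[OF \<open>y > 0\<close>, of n] by simp
  also have "\<dots> = y powr real k" using \<open>n > 0\<close> by (simp add: powr_powr)
  also have "\<dots> = y ^ k" by (rule powr_realpow[OF \<open>y > 0\<close>])
  finally show ?thesis
    using Youngs_inequality_0[of "real k / real n" "1 - real k / real n" "y ^ n" 1] assms \<open>y > 0\<close>
    by simp
qed

context prob_space
begin

text \<open>
  Lyapunov's inequality: unless \<open>X\<close> is zero almost everywhere, it can be normalised to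
  \<open>E |X|^n = 1\<close>, and integrating the pointwise bound of \<open>power_le_weighted_mean\<close> then gives
  \<open>E |X|^k \<le> 1\<close>.
\<close>
lemma integral_abs_power_le_root_power:
  fixes X :: "'a \<Rightarrow> real"
  assumes X: "X \<in> borel_measurable M"
    and int: "integrable M (\<lambda>x. \<bar>X x\<bar> ^ n)" and "n > 0" and "k \<le> n"
  shows "(\<integral>x. \<bar>X x\<bar> ^ k \<partial>M) \<le> root n (\<integral>x. \<bar>X x\<bar> ^ n \<partial>M) ^ k"
proof -
  define s where "s = root n (\<integral>x. \<bar>X x\<bar> ^ n \<partial>M)"
  have L: "(\<integral>x. \<bar>X x\<bar> ^ n \<partial>M) \<ge> 0" by simp
  then have s: "s \<ge> 0" "s ^ n = (\<integral>x. \<bar>X x\<bar> ^ n \<partial>M)"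
    using \<open>n > 0\<close> by (simp_all add: s_def)
  have intk: "integrable M (\<lambda>x. \<bar>X x\<bar> ^ k)"
    using integrable_power_le[OF X int \<open>k \<le> n\<close>] integrable_abs by (force simp: power_abs)
  show ?thesis
  proof (cases "s = 0")
    case True
    then have "AE x in M. \<bar>X x\<bar> ^ n = 0"
      using s(2) \<open>n > 0\<close> int
      by (subst integral_nonneg_eq_0_iff_AE[symmetric]) (auto simp: power_0_left)
    then have "AE x in M. \<bar>X x\<bar> ^ k = 0 ^ k" by eventually_elim simp
    then have "(\<integral>x. \<bar>X x\<bar> ^ k \<partial>M) = (\<integral>x. 0 ^ k \<partial>M)"
      by (rule integral_cong_AE[rotated 2]) (use X in measurable)
    then show ?thesis using True by (simp add: s_def prob_space)
  next
    case False
    then have "s > 0" using s by simp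
    let ?t = "real k / real n"
    have "\<bar>X x\<bar> ^ k \<le> s ^ k * (?t * (\<bar>X x\<bar> ^ n / s ^ n) + (1 - ?t))" for x
    proof -
      have "\<bar>X x\<bar> ^ k / s ^ k \<le> ?t * (\<bar>X x\<bar> ^ n / s ^ n) + (1 - ?t)"
        using power_le_weighted_mean[of "\<bar>X x\<bar> / s" k n] \<open>s > 0\<close> \<open>n > 0\<close> \<open>k \<le> n\<close>
        by (simp add: power_divide)
      then show ?thesis using \<open>s > 0\<close> by (simp add: field_simps)
    qed
    then have "(\<integral>x. \<bar>X x\<bar> ^ k \<partial>M) \<le> (\<integral>x. s ^ k * (?t * (\<bar>X x\<bar> ^ n / s ^ n) + (1 - ?t)) \<partial>M)"
      using int intk by (intro integral_mono) auto
    also have "\<dots> = s ^ k * (?t * ((\<integral>x. \<bar>X x\<bar> ^ n \<partial>M) / s ^ n) + (1 - ?t))"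
      using int by (simp add: prob_space)
    also have "\<dots> = s ^ k" using s \<open>s > 0\<close> by (simp add: s(2)[symmetric])
    finally show ?thesis by (simp add: s_def)
  qed
qed

lemma abs_prod_moment_le:
  fixes X :: "'a \<Rightarrow> real"
  assumes X: "X \<in> borel_measurable M"
    and int: "integrable M (\<lambda>x. \<bar>X x\<bar> ^ n)" and "n > 0" and P: "partition_on {1..n} P"
  shows "\<bar>\<Prod>B\<in>P. moment M X (card B)\<bar> \<le> (\<integral>x. \<bar>X x\<bar> ^ n \<partial>M)"
proof -
  let ?s = "root n (\<integral>x. \<bar>X x\<bar> ^ n \<partial>M)"
  have "\<bar>moment M X (card B)\<bar> \<le> ?s ^ card B" if "B \<in> P" for B
  proof -
    have "B \<subseteq> {1..n}" using P that by (auto simp: partition_on_def)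
    then have "card B \<le> n" using card_mono[of "{1..n}" B] by simp
    have "\<bar>moment M X (card B)\<bar> \<le> (\<integral>x. \<bar>X x ^ card B\<bar> \<partial>M)"
      unfolding moment_def by (rule integral_abs_bound)
    also have "\<dots> \<le> ?s ^ card B"
      using integral_abs_power_le_root_power[OF X int \<open>n > 0\<close> \<open>card B \<le> n\<close>] by (simp add: power_abs)
    finally show ?thesis .
  qed
  then have "\<bar>\<Prod>B\<in>P. moment M X (card B)\<bar> \<le> (\<Prod>B\<in>P. ?s ^ card B)"
    unfolding abs_prod by (intro prod_mono) auto
  also have "\<dots> = ?s ^ (\<Sum>B\<in>P. card B)" by (simp add: power_sum)
  also have "(\<Sum>B\<in>P. card B) = card {1..n}"
  proof (rule product_partition[OF P, symmetric])
    fix B assume "B \<in> P"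
    then have "B \<subseteq> {1..n}" using P by (auto simp: partition_on_def)
    then show "finite B" by (rule finite_subset) simp
  qed
  also have "?s ^ card {1..n} = (\<integral>x. \<bar>X x\<bar> ^ n \<partial>M)" using \<open>n > 0\<close> by simp
  finally show ?thesis .
qed

end

section \<open>Strict inequality\<close>

lemma abs_sum_less_sum:
  fixes t c :: "'b \<Rightarrow> real"
  assumes "finite F" and le: "\<And>P. P \<in> F \<Longrightarrow> \<bar>t P\<bar> \<le> c P"
    and p: "p \<in> F" "- c p < t p" and q: "q \<in> F" "t q < c q"
  shows "\<bar>sum t F\<bar> < sum c F"
proof -
  have "sum t F < sum c F"
    by (rule sum_strict_mono_ex1) (use assms abs_le_D1 in blast)+
  moreover have "sum (\<lambda>P. - c P) F < sum t F"
    by (rule sum_strict_mono_ex1) (use assms in \<open>force simp: abs_le_iff\<close>)+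
  ultimately show ?thesis by (simp add: sum_negf abs_less_iff)
qed

context prob_space
begin

text \<open>
  The set \<open>F\<close> collects the partitions that are counted in the coefficient; outside it the products
  of moments must vanish. The two witnesses \<open>p\<close> and \<open>q\<close> exclude that all terms attain the extreme
  value of the same sign.
\<close>
lemma abs_cumulant_less:
  fixes X :: "'a \<Rightarrow> real"
  defines "t \<equiv> \<lambda>P. (-1) ^ (card P - 1) * (\<Prod>B\<in>P. moment M X (card B))"
  assumes X: "X \<in> borel_measurable M"
    and int: "integrable M (\<lambda>x. \<bar>X x\<bar> ^ n)" and "n > 0"
    and F: "F \<subseteq> set_partitions n"
    and zero: "\<And>P. P \<in> set_partitions n - F \<Longrightarrow> (\<Prod>B\<in>P. moment M X (card B)) = 0"
    and p: "p \<in> F" "- (\<integral>x. \<bar>X x\<bar> ^ n \<partial>M) < t p"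
    and q: "q \<in> F" "t q < (\<integral>x. \<bar>X x\<bar> ^ n \<partial>M)"
  shows "\<bar>cumulant M X n\<bar> < real (\<Sum>P\<in>F. fact (card P - 1)) * (\<integral>x. \<bar>X x\<bar> ^ n \<partial>M)"
proof -
  let ?L = "\<integral>x. \<bar>X x\<bar> ^ n \<partial>M"
  let ?w = "\<lambda>P. fact (card P - 1) :: real"
  have "cumulant M X n = (\<Sum>P\<in>F. ?w P * t P)"
    unfolding cumulant_def t_def
    by (rule sum.mono_neutral_cong_right[OF finite_set_partitions F]) (use zero in auto)
  moreover have "\<bar>\<Sum>P\<in>F. ?w P * t P\<bar> < (\<Sum>P\<in>F. ?w P * ?L)"
  proof (rule abs_sum_less_sum)
    show "finite F" using F finite_set_partitions finite_subset by blast
    show "\<bar>?w P * t P\<bar> \<le> ?w P * ?L" if "P \<in> F" for P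
      using abs_prod_moment_le[OF X int \<open>n > 0\<close>, of P] F that
      by (auto simp: t_def abs_mult set_partitions_def power_abs)
    show "- (?w p * ?L) < ?w p * t p"
      using p(2) mult_strict_left_mono[of "- ?L" "t p" "?w p"] by simp
    show "?w q * t q < ?w q * ?L" using q(2) by simp
  qed (use p q in auto)
  ultimately show ?thesis by (simp add: sum_distrib_right)
qed

lemma integral_abs_power_pos:
  fixes X :: "'a \<Rightarrow> real"
  assumes nd: "\<not> (AE x in M. X x = 0)" and int: "integrable M (\<lambda>x. \<bar>X x\<bar> ^ n)"
  shows "(\<integral>x. \<bar>X x\<bar> ^ n \<partial>M) > 0"
proof -
  have "\<not> (AE x in M. \<bar>X x\<bar> ^ n = 0)"
  proof
    assume "AE x in M. \<bar>X x\<bar> ^ n = 0"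
    then have "AE x in M. X x = 0" by eventually_elim simp
    with nd show False ..
  qed
  then have "(\<integral>x. \<bar>X x\<bar> ^ n \<partial>M) \<noteq> 0"
    using integral_nonneg_eq_0_iff_AE[OF int] by simp
  moreover have "(\<integral>x. \<bar>X x\<bar> ^ n \<partial>M) \<ge> 0" by simp
  ultimately show ?thesis by linarith
qed

lemma two_plus_rest_partition:
  assumes "n \<ge> 3"
  shows "{{1..2}, {3..n}} \<in> set_partitions n"
proof -
  have "{1..n} - {1..2} = {3..n}" by auto
  then have "partition_on {1..n} (insert {1..2} {{3..n}})"
    using assms partition_on_space[of "{3..n}"] by (subst partition_on_insert) (auto simp: disjnt_iff)
  then show ?thesis by (simp add: set_partitions_def)
qed

text \<open>
  The two designated partitions have one and two blocks, hence opposite signs, while all their block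
  sizes are even, so that their products of moments are nonnegative.
\<close>
lemma abs_cumulant_less_even:
  fixes X :: "'a \<Rightarrow> real"
  assumes X: "X \<in> borel_measurable M"
    and int: "integrable M (\<lambda>x. \<bar>X x\<bar> ^ n)" and nd: "\<not> (AE x in M. X x = 0)"
    and n: "even n" "n \<ge> 4"
    and F: "F \<subseteq> set_partitions n" "{{1..n}} \<in> F" "{{1..2}, {3..n}} \<in> F"
    and zero: "\<And>P. P \<in> set_partitions n - F \<Longrightarrow> (\<Prod>B\<in>P. moment M X (card B)) = 0"
  shows "\<bar>cumulant M X n\<bar> < real (\<Sum>P\<in>F. fact (card P - 1)) * (\<integral>x. \<bar>X x\<bar> ^ n \<partial>M)"
proof (rule abs_cumulant_less[OF X int _ F(1) zero F(2) _ F(3)])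
  have L: "(\<integral>x. \<bar>X x\<bar> ^ n \<partial>M) > 0" using integral_abs_power_pos[OF nd int] .
  have even_moment: "moment M X k \<ge> 0" if "even k" for k
    unfolding moment_def using that by (intro integral_nonneg_AE) (simp add: zero_le_even_power)
  have "moment M X (card {1..n}) \<ge> 0" using even_moment n by simp
  with L show "- (\<integral>x. \<bar>X x\<bar> ^ n \<partial>M) <
      (-1) ^ (card {{1..n}} - 1) * (\<Prod>B\<in>{{1..n}}. moment M X (card B))" by simp
  have "{1..2} \<noteq> {3..n}" by auto
  moreover have "moment M X (card {1..2::nat}) * moment M X (card {3..n}) \<ge> 0"
    using even_moment n by (intro mult_nonneg_nonneg) auto
  ultimately show "(-1) ^ (card {{1..2}, {3..n}} - 1) * (\<Prod>B\<in>{{1..2}, {3..n}}. moment M X (card B))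
      < (\<integral>x. \<bar>X x\<bar> ^ n \<partial>M)" using L by simp
qed (use n in auto)

text \<open>
  Jensen's inequality is strict here: \<open>(E X)^2 < E X^2\<close> by positivity of the variance, and Lyapunov's
  inequality passes from the second to the \<open>n\<close>-th absolute moment.
\<close>
lemma power_integral_less:
  fixes X :: "'a \<Rightarrow> real"
  assumes X: "X \<in> borel_measurable M"
    and int: "integrable M (\<lambda>x. \<bar>X x\<bar> ^ n)" and nd: "\<not> (\<exists>c. AE x in M. X x = c)" and "n \<ge> 2"
  shows "\<bar>\<integral>x. X x \<partial>M\<bar> ^ n < (\<integral>x. \<bar>X x\<bar> ^ n \<partial>M)"
proof -
  let ?s = "root n (\<integral>x. \<bar>X x\<bar> ^ n \<partial>M)" and ?\<mu> = "\<integral>x. X x \<partial>M"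
  have int1: "integrable M X" and int2: "integrable M (\<lambda>x. (X x)\<^sup>2)"
    using integrable_power_le[OF X int, of 1] integrable_power_le[OF X int, of 2] \<open>n \<ge> 2\<close> by simp_all
  have intc: "integrable M (\<lambda>x. \<bar>X x - ?\<mu>\<bar> ^ 2)"
    using int1 int2 by (simp add: power2_diff)
  have "\<not> (AE x in M. X x - ?\<mu> = 0)" using nd by auto
  from integral_abs_power_pos[OF this intc] have "?\<mu>\<^sup>2 < (\<integral>x. (X x)\<^sup>2 \<partial>M)"
    using variance_eq[OF int1 int2] by simp
  also have "\<dots> \<le> ?s\<^sup>2"
    using integral_abs_power_le_root_power[OF X int, of 2] \<open>n \<ge> 2\<close> by simp
  finally have "\<bar>?\<mu>\<bar>\<^sup>2 < ?s\<^sup>2" by simp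
  moreover have "?s \<ge> 0" by (rule real_root_ge_zero) simp
  ultimately have "\<bar>?\<mu>\<bar> < ?s" by (rule power2_less_imp_less)
  then have "\<bar>?\<mu>\<bar> ^ n < ?s ^ n" using \<open>n \<ge> 2\<close> by (intro power_strict_mono) auto
  then show ?thesis using \<open>n \<ge> 2\<close> by simp
qed

text \<open>
  Equality would give \<open>X^n = |X|^n\<close>, hence \<open>X \<ge> 0\<close>, almost everywhere; with mean zero this means
  \<open>X = 0\<close>.
\<close>
lemma integral_odd_power_less:
  fixes X :: "'a \<Rightarrow> real"
  assumes X: "X \<in> borel_measurable M"
    and int: "integrable M (\<lambda>x. \<bar>X x\<bar> ^ n)" and nd: "\<not> (AE x in M. X x = 0)"
    and mean: "(\<integral>x. X x \<partial>M) = 0" and "odd n"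
  shows "(\<integral>x. X x ^ n \<partial>M) < (\<integral>x. \<bar>X x\<bar> ^ n \<partial>M)"
proof -
  have n: "1 \<le> n" using \<open>odd n\<close> odd_pos by force
  have intn: "integrable M (\<lambda>x. X x ^ n)" using integrable_power_le[OF X int, of n] by simp
  have int1: "integrable M X" using integrable_power_le[OF X int n] by simp
  have le: "X x ^ n \<le> \<bar>X x\<bar> ^ n" for x by (metis abs_ge_self power_abs)
  have "(\<integral>x. \<bar>X x\<bar> ^ n - X x ^ n \<partial>M) \<noteq> 0"
  proof
    assume "(\<integral>x. \<bar>X x\<bar> ^ n - X x ^ n \<partial>M) = 0"
    then have "AE x in M. \<bar>X x\<bar> ^ n - X x ^ n = 0"
      using int intn le by (subst integral_nonneg_eq_0_iff_AE[symmetric]) auto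
    then have "AE x in M. X x \<ge> 0"
    proof eventually_elim
      case (elim x)
      then have "X x ^ n \<ge> 0" by (metis eq_iff_diff_eq_0 zero_le_power_abs)
      then show ?case using \<open>odd n\<close> by (simp add: zero_le_odd_power)
    qed
    then have "AE x in M. X x = 0" using integral_nonneg_eq_0_iff_AE[OF int1] mean by simp
    with nd show False ..
  qed
  moreover have "(\<integral>x. \<bar>X x\<bar> ^ n - X x ^ n \<partial>M) \<ge> 0" using le by simp
  ultimately show ?thesis using int intn by simp
qed

lemma moment_odd_symmetric:
  fixes X :: "'a \<Rightarrow> real"
  assumes [measurable]: "X \<in> borel_measurable M" and sym: "symmetric_rv M X" and "odd k"
  shows "moment M X k = 0"
proof -
  have "moment M X k = (\<integral>y. y ^ k \<partial>distr M borel X)"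
    unfolding moment_def by (rule integral_distr[symmetric]) measurable
  also have "\<dots> = (\<integral>y. y ^ k \<partial>distr M borel (\<lambda>x. - X x))"
    using sym by (simp add: symmetric_rv_def)
  also have "\<dots> = (\<integral>x. (- X x) ^ k \<partial>M)" by (rule integral_distr) measurable
  also have "\<dots> = - moment M X k" using \<open>odd k\<close> by (simp add: moment_def)
  finally show ?thesis by simp
qed

section \<open>The three bounds\<close>

lemma abs_cumulant_less_C_raw:
  fixes X :: "'a \<Rightarrow> real"
  assumes X: "X \<in> borel_measurable M"
    and int: "integrable M (\<lambda>x. \<bar>X x\<bar> ^ n)" and nd: "\<not> (\<exists>c. AE x in M. X x = c)" and "n \<ge> 2"
  shows "\<bar>cumulant M X n\<bar> < real (C_raw n) * (\<integral>x. \<bar>X x\<bar> ^ n \<partial>M)"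
proof -
  \<comment> \<open>the partition into singletons, whose product of moments is the \<open>n\<close>-th power of the mean\<close>
  let ?p = "(\<lambda>i. {i}) ` {1..n}"
  have "(\<Prod>B\<in>?p. moment M X (card B)) = (\<integral>x. X x \<partial>M) ^ n"
    by (subst prod.reindex) (auto simp: moment_def)
  then have "\<bar>(-1) ^ (card ?p - 1) * (\<Prod>B\<in>?p. moment M X (card B))\<bar> = \<bar>\<integral>x. X x \<partial>M\<bar> ^ n"
    by (simp add: abs_mult power_abs)
  also have "\<dots> < (\<integral>x. \<bar>X x\<bar> ^ n \<partial>M)"
    by (rule power_integral_less[OF X int nd \<open>n \<ge> 2\<close>])
  finally have strict: "\<bar>(-1) ^ (card ?p - 1) * (\<Prod>B\<in>?p. moment M X (card B))\<bar> < (\<integral>x. \<bar>X x\<bar> ^ n \<partial>M)" .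
  have p: "?p \<in> set_partitions n"
    unfolding set_partitions_def using partition_on_singletons[of "{1..n}"] by simp
  show ?thesis
    unfolding C_raw_def
  proof (rule abs_cumulant_less[OF X int _ order_refl _ p _ p])
    show "n > 0" using \<open>n \<ge> 2\<close> by simp
  qed (use strict in \<open>(simp only: abs_less_iff; linarith) | simp\<close>)+
qed

text \<open>
  The first moment is zero, so every partition with a singleton block has product zero and only the
  partitions counted by \<open>C_cen\<close> remain.
\<close>
lemma abs_cumulant_less_C_cen_centred:
  fixes X :: "'a \<Rightarrow> real"
  assumes X: "X \<in> borel_measurable M"
    and int: "integrable M (\<lambda>x. \<bar>X x\<bar> ^ n)" and nd: "\<not> (AE x in M. X x = 0)"
    and mean: "(\<integral>x. X x \<partial>M) = 0" and "n \<ge> 3"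
  shows "\<bar>cumulant M X n\<bar> < real (C_cen n) * (\<integral>x. \<bar>X x\<bar> ^ n \<partial>M)"
proof -
  let ?F = "{P \<in> set_partitions n. \<forall>B\<in>P. card B \<ge> 2}"
  have sub: "?F \<subseteq> set_partitions n" by auto
  have whole: "{{1..n}} \<in> ?F"
    using \<open>n \<ge> 3\<close> partition_on_space[of "{1..n}"] by (simp add: set_partitions_def)
  have zero: "(\<Prod>B\<in>P. moment M X (card B)) = 0" if "P \<in> set_partitions n - ?F" for P
  proof -
    have P: "partition_on {1..n} P" using that by (simp add: set_partitions_def)
    have "\<exists>B\<in>P. \<not> 2 \<le> card B" using that by blast
    then obtain B where B: "B \<in> P" "card B < 2" by auto
    have "finite B" "B \<noteq> {}"
      using P B finite_subset[of B "{1..n}"] by (auto simp: partition_on_def)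
    then have "card B \<noteq> 0" by simp
    then have "card B = 1" using B(2) by linarith
    then have "moment M X (card B) = 0" using mean by (simp add: moment_def)
    then show ?thesis using B finite_elements[OF _ P] by (auto intro!: prod_zero)
  qed
  show ?thesis
  proof (cases "even n")
    case True
    then have "n \<ge> 4" using \<open>n \<ge> 3\<close> by presburger
    then have "{{1..2}, {3..n}} \<in> ?F" using two_plus_rest_partition[of n] by simp
    then show ?thesis unfolding C_cen_def
      using abs_cumulant_less_even[OF X int nd True \<open>n \<ge> 4\<close> sub whole _ zero] by simp
  next
    case False
    have "(\<integral>x. X x ^ n \<partial>M) < (\<integral>x. \<bar>X x\<bar> ^ n \<partial>M)"
      using integral_odd_power_less[OF X int nd mean False] .
    \<comment> \<open>the hypotheses are invariant under changing the sign of \<open>X\<close>, which gives the lower bound\<close>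
    moreover have "(\<integral>x. (- X x) ^ n \<partial>M) < (\<integral>x. \<bar>- X x\<bar> ^ n \<partial>M)"
      by (rule integral_odd_power_less) (use X int nd mean False in auto)
    ultimately have strict: "(\<integral>x. X x ^ n \<partial>M) < (\<integral>x. \<bar>X x\<bar> ^ n \<partial>M)"
      "- (\<integral>x. \<bar>X x\<bar> ^ n \<partial>M) < (\<integral>x. X x ^ n \<partial>M)"
      using False by simp_all
    show ?thesis unfolding C_cen_def
      by (rule abs_cumulant_less[OF X int _ sub zero whole _ whole])
        (use strict \<open>n \<ge> 3\<close> in \<open>simp_all add: moment_def\<close>)
  qed
qed

lemma abs_cumulant_less_C_cen:
  fixes X :: "'a \<Rightarrow> real"
  assumes X: "X \<in> borel_measurable M"
    and int: "integrable M (\<lambda>x. \<bar>X x\<bar> ^ n)" and nd: "\<not> (\<exists>c. AE x in M. X x = c)" and "n \<ge> 3"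
  shows "\<bar>cumulant M X n\<bar> < real (C_cen n) * (\<integral>x. \<bar>X x - (\<integral>y. X y \<partial>M)\<bar> ^ n \<partial>M)"
proof -
  define a where "a = - (\<integral>y. X y \<partial>M)"
  have int1: "integrable M X" using integrable_power_le[OF X int, of 1] \<open>n \<ge> 3\<close> by simp
  have "\<bar>cumulant M (\<lambda>x. X x + a) n\<bar> < real (C_cen n) * (\<integral>x. \<bar>X x + a\<bar> ^ n \<partial>M)"
  proof (rule abs_cumulant_less_C_cen_centred)
    show "(\<lambda>x. X x + a) \<in> borel_measurable M" using X by simp
    show "integrable M (\<lambda>x. \<bar>X x + a\<bar> ^ n)"
      using integrable_power_mult_shift_power[OF X int, of 0 n a] integrable_abs
      by (force simp: power_abs)
    show "\<not> (AE x in M. X x + a = 0)"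
    proof
      assume "AE x in M. X x + a = 0"
      then have "AE x in M. X x = - a" by eventually_elim simp
      with nd show False by blast
    qed
    show "(\<integral>x. X x + a \<partial>M) = 0" using int1 by (simp add: a_def prob_space)
  qed fact
  then show ?thesis using cumulant_shift[OF X int, of a] \<open>n \<ge> 3\<close> by (simp add: a_def)
qed

lemma abs_cumulant_less_C_sym:
  fixes X :: "'a \<Rightarrow> real"
  assumes X: "X \<in> borel_measurable M"
    and int: "integrable M (\<lambda>x. \<bar>X x\<bar> ^ n)" and nd: "\<not> (AE x in M. X x = 0)"
    and sym: "symmetric_rv M X" and n: "even n" "n \<ge> 4"
  shows "\<bar>cumulant M X n\<bar> < real (C_sym n) * (\<integral>x. \<bar>X x\<bar> ^ n \<partial>M)"
proof -
  let ?F = "{P \<in> set_partitions n. \<forall>B\<in>P. even (card B)}"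
  have zero: "(\<Prod>B\<in>P. moment M X (card B)) = 0" if "P \<in> set_partitions n - ?F" for P
  proof -
    have P: "partition_on {1..n} P" using that by (simp add: set_partitions_def)
    have "\<exists>B\<in>P. odd (card B)" using that by blast
    then obtain B where "B \<in> P" "odd (card B)" by blast
    then show ?thesis
      using moment_odd_symmetric[OF X sym] finite_elements[OF _ P] by (auto intro!: prod_zero)
  qed
  show ?thesis unfolding C_sym_def
  proof (rule abs_cumulant_less_even[OF X int nd n])
    show "{{1..n}} \<in> ?F"
      using n partition_on_space[of "{1..n}"] by (simp add: set_partitions_def)
    show "{{1..2}, {3..n}} \<in> ?F" using n two_plus_rest_partition[of n] by simp
  qed (use zero in auto)
qed

end

theorem proposition7p1:
  fixes M :: "'a measure" and X :: "'a \<Rightarrow> real" and n :: nat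
  assumes "prob_space M"
    and "X \<in> borel_measurable M"
    and "\<not> (\<exists>c. AE x in M. X x = c)"
    and "n > 0"
    and "integrable M (\<lambda>x. \<bar>X x\<bar> ^ n)"
  shows "(n \<ge> 2 \<longrightarrow>
            \<bar>cumulant M X n\<bar> < real (C_raw n) * (\<integral>x. \<bar>X x\<bar> ^ n \<partial>M)) \<and>
         (n \<ge> 3 \<longrightarrow>
            \<bar>cumulant M X n\<bar> < real (C_cen n) * (\<integral>x. \<bar>X x - (\<integral>y. X y \<partial>M)\<bar> ^ n \<partial>M)) \<and>
         (symmetric_rv M X \<and> n \<ge> 4 \<and> even n \<longrightarrow>
            \<bar>cumulant M X n\<bar> < real (C_sym n) * (\<integral>x. \<bar>X x\<bar> ^ n \<partial>M))"
proof (intro conjI impI)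
  interpret prob_space M by fact
  show "\<bar>cumulant M X n\<bar> < real (C_raw n) * (\<integral>x. \<bar>X x\<bar> ^ n \<partial>M)" if "n \<ge> 2"
    by (rule abs_cumulant_less_C_raw) (use assms that in simp_all)
  show "\<bar>cumulant M X n\<bar> < real (C_cen n) * (\<integral>x. \<bar>X x - (\<integral>y. X y \<partial>M)\<bar> ^ n \<partial>M)" if "n \<ge> 3"
    by (rule abs_cumulant_less_C_cen) (use assms that in simp_all)
  show "\<bar>cumulant M X n\<bar> < real (C_sym n) * (\<integral>x. \<bar>X x\<bar> ^ n \<partial>M)"
    if "symmetric_rv M X \<and> n \<ge> 4 \<and> even n"
    using assms that by (intro abs_cumulant_less_C_sym) blast+
qed

end
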